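(* Let $(\Omega,\mu)$ be a $\sigma$-finite measure space (with $\mu$ a positive measure) with infinite measure, $\mu(\Omega)=\infty$, and let $\mathcal{H}$ be an infinite dimensional separable complex Hilbert space. Then there exists a continuous frame $F:\Omega\to\mathcal{H}$ with respect to $(\Omega,\mu)$.
   Context: Let $\mathcal{H}$ be a complex Hilbert space and $(\Omega,\mu)$ a measure space with positive measure $\mu$. A mapping $F:\Omega\to\mathcal{H}$ is a continuous frame with respect to $(\Omega,\mu)$ if (1) $F$ is weakly measurable, i.e. for every $f\in\mathcal{H}$ the function $\omega\mapsto\langle f,F(\omega)\rangle$ is measurable on $\Omega$; and (2) there exist constants $A,B>0$ such that $A\|f\|^2\le\int_\Omega|\langle f,F(\omega)\rangle|^2\,d\mu(\omega)\le B\|f\|^2$ for all $f\in\mathcal{H}$. *)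

theory Defs
  imports "HOL-Analysis.Analysis"
begin

class complex_vector = real_vector +
  fixes scaleC :: "complex \<Rightarrow> 'a \<Rightarrow> 'a"
  assumes scaleC_add_right: "scaleC c (x + y) = scaleC c x + scaleC c y"
    and scaleC_add_left: "scaleC (c + d) x = scaleC c x + scaleC d x"
    and scaleC_scaleC: "scaleC c (scaleC d x) = scaleC (c * d) x"
    and scaleC_of_real: "scaleC (complex_of_real r) x = scaleR r x"

global_interpretation complex_vector: vector_space "scaleC :: complex \<Rightarrow> 'a \<Rightarrow> 'a::complex_vector"
  defines cspan = complex_vector.span
proof
  fix x :: 'a
  show "scaleC 1 x = x"
    using scaleC_of_real[of 1 x] by simp
qed (simp_all add: scaleC_add_right scaleC_add_left scaleC_scaleC)

text \<open>The inner product is linear in its first argument. Its positive definiteness is part of the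
  last axiom, because the norm is positive definite.\<close>

class complex_inner = complex_vector + real_normed_vector +
  fixes cinner :: "'a \<Rightarrow> 'a \<Rightarrow> complex"
  assumes cinner_commute: "cinner x y = cnj (cinner y x)"
    and cinner_add_left: "cinner (x + y) z = cinner x z + cinner y z"
    and cinner_scaleC_left: "cinner (scaleC c x) y = c * cinner x y"
    and cinner_self_norm: "cinner x x = complex_of_real ((norm x)\<^sup>2)"

class complex_hilbert_space = complex_inner + complete_space

definition cfinite_dimensional :: "'a::complex_vector itself \<Rightarrow> bool"
  where "cfinite_dimensional _ \<longleftrightarrow> (\<exists>B :: 'a set. finite B \<and> cspan B = UNIV)"

definition weakly_measurable :: "'w measure \<Rightarrow> ('w \<Rightarrow> 'h::complex_hilbert_space) \<Rightarrow> bool"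
  where "weakly_measurable M F \<longleftrightarrow> (\<forall>f. (\<lambda>\<omega>. cinner f (F \<omega>)) \<in> borel_measurable M)"

text \<open>The integral is taken in \<^typ>\<open>ennreal\<close>, so the upper bound includes its finiteness.\<close>

definition continuous_frame :: "'w measure \<Rightarrow> ('w \<Rightarrow> 'h::complex_hilbert_space) \<Rightarrow> bool"
  where "continuous_frame M F \<longleftrightarrow>
    weakly_measurable M F \<and>
    (\<exists>A B :: real. A > 0 \<and> B > 0 \<and>
      (\<forall>f. ennreal (A * (norm f)\<^sup>2) \<le> (\<integral>\<^sup>+ \<omega>. ennreal ((cmod (cinner f (F \<omega>)))\<^sup>2) \<partial>M) \<and>
           (\<integral>\<^sup>+ \<omega>. ennreal ((cmod (cinner f (F \<omega>)))\<^sup>2) \<partial>M) \<le> ennreal (B * (norm f)\<^sup>2)))"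

end

theory Submission
  imports Defs
begin

text \<open>
  A countable partition of \<open>\<Omega>\<close> into pieces \<open>A\<^sub>i\<close> of finite measure turns a sequence \<open>e\<close> of vectors
  into a step function with value \<open>e\<^sub>i / sqrt (\<mu> A\<^sub>i)\<close> on \<open>A\<^sub>i\<close>. The integral of
  \<open>\<bar>\<langle>f, F \<omega>\<rangle>\<bar>\<^sup>2\<close> is then the sum of \<open>\<bar>\<langle>f, e\<^sub>i\<rangle>\<bar>\<^sup>2\<close>, provided that \<open>e\<^sub>i = 0\<close> on the null pieces,
  so the task is to find a sequence that satisfies Parseval's identity and vanishes at these
  indices. The frame obtained in this way has both bounds equal to 1.

  Since the total measure is infinite and every piece has finite measure, infinitely many pieces
  have positive measure (\<open>infinite_positive_pieces\<close>). There is thus a sequence \<open>d\<close> with dense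
  range that is zero at the indices of the null pieces. The Gram--Schmidt process,
  run on \<open>d\<close> with the convention that a vector in the span of its predecessors yields 0, keeps
  these zeros and gives a sequence with Parseval's identity (\<open>gram_schmidt_parseval\<close>): the
  residual of \<open>f\<close> after \<open>n\<close> steps has squared norm
  \<open>\<parallel>f\<parallel>\<^sup>2\<close> minus the first \<open>n\<close> terms of the sum, and it tends to 0 because the residual map is
  linear, contracts norms and annihilates \<open>d\<^sub>0, \<dots>, d\<^sub>n\<^sub>-\<^sub>1\<close>.
\<close>

section \<open>Inner product identities\<close>

lemma cinner_diff_left: "cinner (x - y) z = cinner x z - cinner y z"
  for x y z :: "'h::complex_inner"
  using cinner_add_left[of "x - y" y z] by simp

lemma cinner_diff_right: "cinner z (x - y) = cinner z x - cinner z y"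
  for x y z :: "'h::complex_inner"
  by (metis cinner_commute cinner_diff_left complex_cnj_diff)

lemma cinner_scaleC_right: "cinner x (scaleC c y) = cnj c * cinner x y"
  for x y :: "'h::complex_inner"
  by (metis cinner_commute cinner_scaleC_left complex_cnj_mult)

lemma cinner_zero_left [simp]: "cinner 0 x = 0"
  for x :: "'h::complex_inner"
  using cinner_diff_left[of 0 0 x] by simp

lemma cinner_zero_right [simp]: "cinner x 0 = 0"
  for x :: "'h::complex_inner"
  using cinner_diff_right[of x 0 0] by simp

lemma cinner_scaleR_right: "cinner x (scaleR r y) = of_real r * cinner x y"
  for x y :: "'h::complex_inner"
  by (simp add: cinner_scaleC_right flip: scaleC_of_real)

lemma cinner_left_eqI:
  fixes x y :: "'h::complex_inner"
  assumes "\<And>z. cinner x z = cinner y z"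
  shows "x = y"
proof -
  have "cinner (x - y) (x - y) = 0"
    using assms by (simp add: cinner_diff_left)
  then show ?thesis
    by (simp add: cinner_self_norm)
qed

section \<open>Orthogonal projections\<close>

definition remove_component :: "'h \<Rightarrow> 'h \<Rightarrow> 'h::complex_inner"
  where "remove_component e x = x - scaleC (cinner x e) e"

text \<open>Admitting \<open>e = 0\<close> here and below lets the Gram--Schmidt process skip a vector that depends on
  its predecessors.\<close>

lemma norm_remove_component:
  fixes e :: "'h::complex_inner"
  assumes "e = 0 \<or> norm e = 1"
  shows "(norm (remove_component e x))\<^sup>2 = (norm x)\<^sup>2 - (cmod (cinner x e))\<^sup>2"
proof -
  define c where "c = cinner x e"
  have ce: "c * cinner e e = c"
    using assms by (auto simp: c_def cinner_self_norm)
  have ex: "cinner e x = cnj c"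
    unfolding c_def by (rule cinner_commute)
  have "cinner (remove_component e x) (remove_component e x)
      = cinner x x - cnj c * c - c * (cnj c - cnj c * cinner e e)"
    by (simp add: remove_component_def cinner_diff_left cinner_diff_right cinner_scaleC_left
        cinner_scaleC_right ex flip: c_def) (simp add: algebra_simps)
  also have "\<dots> = cinner x x - c * cnj c"
    using ce by (simp add: algebra_simps)
  finally show ?thesis
    by (simp add: cinner_self_norm c_def flip: complex_norm_square of_real_diff of_real_power)
qed

lemma remove_component_sgn_self: "remove_component (sgn x) x = 0"
  for x :: "'h::complex_inner"
proof (cases "x = 0")
  case False
  then have "cinner x (sgn x) = of_real (norm x)"
    by (simp add: sgn_div_norm cinner_scaleR_right cinner_self_norm power2_eq_square)
  then show ?thesis
    using False by (simp add: remove_component_def scaleC_of_real sgn_div_norm)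
qed (simp add: remove_component_def)

definition orthogonal_projection :: "('h \<Rightarrow> 'h::complex_inner) \<Rightarrow> bool"
  where "orthogonal_projection P \<longleftrightarrow>
    (\<forall>x y. cinner (P x) y = cinner x (P y)) \<and> (\<forall>x. P (P x) = P x)"

text \<open>Linearity follows from symmetry, because the inner product is nondegenerate.\<close>

lemma
  fixes P :: "'h \<Rightarrow> 'h::complex_inner"
  assumes "orthogonal_projection P"
  shows orthogonal_projection_diff: "P (x - y) = P x - P y"
    and orthogonal_projection_scaleC: "P (scaleC c x) = scaleC c (P x)"
proof -
  have sym: "cinner (P u) v = cinner u (P v)" for u v
    using assms by (simp add: orthogonal_projection_def)
  show "P (x - y) = P x - P y"
    by (rule cinner_left_eqI) (simp add: cinner_diff_left sym)
  show "P (scaleC c x) = scaleC c (P x)"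
    by (rule cinner_left_eqI) (simp add: cinner_scaleC_left sym)
qed

text \<open>Removing the component along a vector in the range of a projection shrinks the range by
  that direction. Since \<open>P e = e\<close>, the coefficient \<open>\<langle>P x, e\<rangle>\<close> equals \<open>\<langle>x, e\<rangle>\<close>, which is what makes
  the new map symmetric.\<close>

lemma orthogonal_projection_remove_component:
  fixes P :: "'h \<Rightarrow> 'h::complex_inner"
  assumes P: "orthogonal_projection P" and e: "e = 0 \<or> norm e = 1" and Pe: "P e = e"
  shows "orthogonal_projection (\<lambda>x. remove_component e (P x))"
proof -
  let ?Q = "\<lambda>x. remove_component e (P x)"
  have sym: "cinner (P u) v = cinner u (P v)" for u v
    using P by (simp add: orthogonal_projection_def)
  have idem: "P (P u) = P u" for u
    using P by (simp add: orthogonal_projection_def)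
  have Q: "?Q u = P u - scaleC (cinner u e) e" for u
    by (simp add: remove_component_def sym Pe)
  have "cinner (?Q u) v = cinner u (?Q v)" for u v
    by (simp add: Q cinner_diff_left cinner_diff_right cinner_scaleC_left cinner_scaleC_right sym
        cinner_commute[of e v, symmetric])
  moreover have "?Q (?Q u) = ?Q u" for u
  proof -
    have "cinner (?Q u) e = cinner u e - cinner u e * cinner e e"
      by (simp add: Q cinner_diff_left cinner_scaleC_left sym Pe)
    also have "\<dots> = 0"
      using e by (auto simp: cinner_self_norm)
    finally have "cinner (?Q u) e = 0" .
    moreover have "P (?Q u) = ?Q u"
      by (simp add: Q orthogonal_projection_diff[OF P] orthogonal_projection_scaleC[OF P] idem Pe)
    ultimately show ?thesis
      by (simp add: remove_component_def[of e "?Q u"])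
  qed
  ultimately show ?thesis
    by (simp add: orthogonal_projection_def)
qed

section \<open>Gram--Schmidt and Parseval's identity\<close>

text \<open>The projection onto the orthogonal complement of \<open>d\<^sub>0, \<dots>, d\<^sub>n\<^sub>-\<^sub>1\<close>. The zero vector is its own
  \<^const>\<open>sgn\<close>, so a vector that depends on its predecessors removes nothing.\<close>

primrec residual :: "(nat \<Rightarrow> 'h) \<Rightarrow> nat \<Rightarrow> 'h \<Rightarrow> 'h::complex_inner"
  where
    "residual d 0 x = x"
  | "residual d (Suc n) x = remove_component (sgn (residual d n (d n))) (residual d n x)"

definition gram_schmidt :: "(nat \<Rightarrow> 'h) \<Rightarrow> nat \<Rightarrow> 'h::complex_inner"
  where "gram_schmidt d n = sgn (residual d n (d n))"

lemma gram_schmidt_zero_or_unit: "gram_schmidt d n = 0 \<or> norm (gram_schmidt d n) = 1"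
  by (simp add: gram_schmidt_def norm_sgn)

lemma residual_Suc: "residual d (Suc n) x = remove_component (gram_schmidt d n) (residual d n x)"
  by (simp add: gram_schmidt_def)

lemma sgn_in_projection_range:
  fixes P :: "'h \<Rightarrow> 'h::complex_inner"
  assumes "orthogonal_projection P"
  shows "P (sgn (P x)) = sgn (P x)"
proof -
  have "P (P x) = P x"
    using assms by (simp add: orthogonal_projection_def)
  then show ?thesis
    using orthogonal_projection_scaleC[OF assms, of "of_real (inverse (norm (P x)))" "P x"]
    by (simp only: scaleC_of_real sgn_div_norm)
qed

lemma orthogonal_projection_residual: "orthogonal_projection (residual d n)"
proof (induction n)
  case 0
  show ?case
    by (simp add: orthogonal_projection_def)
next
  case (Suc n)
  have "residual d n (gram_schmidt d n) = gram_schmidt d n"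
    unfolding gram_schmidt_def by (rule sgn_in_projection_range[OF Suc])
  from orthogonal_projection_remove_component[OF Suc gram_schmidt_zero_or_unit this]
  show ?case
    by (simp only: residual_Suc[abs_def])
qed

lemma cinner_residual_gram_schmidt:
  "cinner (residual d n x) (gram_schmidt d n) = cinner x (gram_schmidt d n)"
  using orthogonal_projection_residual[of d n]
    sgn_in_projection_range[OF orthogonal_projection_residual, of d n "d n"]
  by (simp add: orthogonal_projection_def gram_schmidt_def)

lemma residual_annihilates: "k < n \<Longrightarrow> residual d n (d k) = 0"
proof (induction n)
  case (Suc n)
  show ?case
  proof (cases "k = n")
    case True
    then show ?thesis
      by (simp add: remove_component_sgn_self)
  next
    case False
    then show ?thesis
      using Suc by (simp add: remove_component_def)
  qed
qed simp

lemma norm_residual: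
  "(norm (residual d n x))\<^sup>2 = (norm x)\<^sup>2 - (\<Sum>i<n. (cmod (cinner x (gram_schmidt d i)))\<^sup>2)"
proof (induction n)
  case (Suc n)
  have "(norm (residual d (Suc n) x))\<^sup>2
      = (norm (residual d n x))\<^sup>2 - (cmod (cinner x (gram_schmidt d n)))\<^sup>2"
    by (simp only: residual_Suc norm_remove_component[OF gram_schmidt_zero_or_unit]
        cinner_residual_gram_schmidt)
  then show ?case
    using Suc by simp
qed simp

lemma norm_residual_le: "norm (residual d n x) \<le> norm x"
proof (rule power2_le_imp_le)
  show "(norm (residual d n x))\<^sup>2 \<le> (norm x)\<^sup>2"
    unfolding norm_residual by (simp add: sum_nonneg)
qed simp

text \<open>Once \<open>d\<^sub>k\<close> has been processed, the residual of \<open>x\<close> is that of \<open>x - d\<^sub>k\<close>, and so its norm is at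
  most the distance from \<open>x\<close> to \<open>d\<^sub>k\<close>.\<close>

lemma residual_tendsto_0:
  assumes "closure (range d) = UNIV"
  shows "(\<lambda>n. residual d n x) \<longlonglongrightarrow> 0"
proof (rule LIMSEQ_I)
  fix r :: real
  assume "r > 0"
  have "x \<in> closure (range d)"
    using assms by simp
  then obtain k where k: "dist (d k) x < r"
    using \<open>r > 0\<close> unfolding closure_approachable by blast
  have "norm (residual d n x) < r" if "n > k" for n
  proof -
    have "residual d n x = residual d n (x - d k)"
      using orthogonal_projection_diff[OF orthogonal_projection_residual, of d n x "d k"]
        residual_annihilates[OF that, of d]
      by simp
    also have "norm \<dots> \<le> norm (x - d k)"
      by (rule norm_residual_le)
    also have "\<dots> < r"
      using k by (simp add: dist_norm norm_minus_commute)
    finally show ?thesis .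
  qed
  then show "\<exists>no. \<forall>n\<ge>no. norm (residual d n x - 0) < r"
    by (intro exI[of _ "Suc k"]) auto
qed

lemma gram_schmidt_parseval:
  assumes "closure (range d) = UNIV"
  shows "(\<lambda>i. (cmod (cinner x (gram_schmidt d i)))\<^sup>2) sums (norm x)\<^sup>2"
proof -
  have "(\<lambda>n. (norm x)\<^sup>2 - (norm (residual d n x))\<^sup>2) \<longlonglongrightarrow> (norm x)\<^sup>2 - (norm (0::'a))\<^sup>2"
    by (intro tendsto_intros residual_tendsto_0[OF assms])
  then show ?thesis
    by (simp add: sums_def norm_residual)
qed

lemma gram_schmidt_eq_0: "d n = 0 \<Longrightarrow> gram_schmidt d n = 0"
  using orthogonal_projection_diff[OF orthogonal_projection_residual, of d n 0 0]
  by (simp add: gram_schmidt_def)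

section \<open>From the measure space to the frame\<close>

text \<open>Otherwise the total measure would be a sum of finitely many finite terms.\<close>

lemma infinite_positive_pieces:
  fixes A :: "nat \<Rightarrow> 'w set"
  assumes meas: "range A \<subseteq> sets M" and disj: "disjoint_family A"
    and fin: "\<And>i. emeasure M (A i) \<noteq> \<infinity>" and inf: "emeasure M (\<Union>i. A i) = \<infinity>"
  shows "infinite {i. emeasure M (A i) \<noteq> 0}"
proof
  assume I: "finite {i. emeasure M (A i) \<noteq> 0}"
  have "emeasure M (\<Union>i. A i) = (\<Sum>i. emeasure M (A i))"
    using suminf_emeasure[OF meas disj] by simp
  also have "\<dots> = (\<Sum>i\<in>{i. emeasure M (A i) \<noteq> 0}. emeasure M (A i))"
    by (rule suminf_finite[OF I]) simp
  also have "\<dots> \<noteq> \<infinity>"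
    using I fin by simp
  finally show False
    using inf by simp
qed

text \<open>Spreading the dense sequence over the indices in \<open>I\<close> lets the pieces of the partition and the
  vectors share one index set, so that Parseval's sum needs no reindexing.\<close>

lemma dense_sequence_supported_on:
  fixes I :: "nat set"
  assumes sep: "separable_space (euclidean :: 'h::{topological_space, zero} topology)"
    and I: "infinite I"
  obtains d :: "nat \<Rightarrow> 'h::{topological_space, zero}" where "closure (range d) = UNIV" "\<And>i. i \<notin> I \<Longrightarrow> d i = 0"
proof -
  obtain C :: "'h set" where C: "countable C" "closure C = UNIV"
    using sep by (auto simp: separable_space_def)
  have "C \<noteq> {}"
    using C by auto
  define d where "d i = (if i \<in> I then from_nat_into C (inv_into UNIV (enumerate I) i) else 0)" for i
  have "from_nat_into C n \<in> range d" for n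
  proof -
    have "d (enumerate I n) = from_nat_into C n"
      using enumerate_in_set[OF I, of n]
        inv_into_f_f[OF bij_betw_imp_inj_on[OF bij_enumerate[OF I]], of n]
      by (simp add: d_def)
    then show ?thesis
      by (metis rangeI)
  qed
  then have "range (from_nat_into C) \<subseteq> range d"
    by (rule image_subsetI)
  then have "C \<subseteq> range d"
    by (simp add: range_from_nat_into[OF \<open>C \<noteq> {}\<close> C(1)])
  then have "closure (range d) = UNIV"
    using C(2) closure_mono by blast
  then show ?thesis
    by (rule that) (simp add: d_def)
qed

theorem proposition3p2:
  fixes M :: "'w measure"
  assumes "sigma_finite_measure M"
    and "emeasure M (space M) = \<infinity>"
    and "separable_space (euclidean :: 'h::complex_hilbert_space topology)"
    and "\<not> cfinite_dimensional TYPE('h)"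
  shows "\<exists>F :: 'w \<Rightarrow> 'h. continuous_frame M F"
proof -
  obtain A :: "nat \<Rightarrow> 'w set" where A: "range A \<subseteq> sets M" "(\<Union>i. A i) = space M"
      "\<And>i. emeasure M (A i) \<noteq> \<infinity>" "disjoint_family A"
    using sigma_finite_measure.sigma_finite_disjoint[OF assms(1)] by blast
  have Am [measurable]: "A i \<in> sets M" for i
    using A(1) by auto
  define I where "I = {i. emeasure M (A i) \<noteq> 0}"
  have "infinite I"
    unfolding I_def by (rule infinite_positive_pieces) (use A assms(2) in auto)
  then obtain d :: "nat \<Rightarrow> 'h" where d: "closure (range d) = UNIV" "\<And>i. i \<notin> I \<Longrightarrow> d i = 0"
    using dense_sequence_supported_on[OF assms(3)] by metis
  define m where "m i = measure M (A i)" for i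
  have m: "emeasure M (A i) = ennreal (m i)" for i
    using A(3)[of i] by (simp add: m_def emeasure_eq_ennreal_measure)
  \<comment> \<open>On a null piece the division by zero yields the factor 0; the vector is 0 there anyway.\<close>
  define c where "c i = scaleR (1 / sqrt (m i)) (gram_schmidt d i)" for i
  \<comment> \<open>The piece containing \<open>\<omega>\<close> is unique; \<open>LEAST\<close> makes its index visibly measurable.\<close>
  define piece where "piece \<omega> = (LEAST i. \<omega> \<in> A i)" for \<omega>
  have piece: "piece \<omega> = i" if "\<omega> \<in> A i" for \<omega> i
    unfolding piece_def
  proof (rule Least_equality)
    show "i \<le> j" if "\<omega> \<in> A j" for j
      using \<open>\<omega> \<in> A i\<close> that A(4) by (cases "i = j") (auto simp: disjoint_family_on_def)
  qed (rule that)
  have [measurable]: "piece \<in> measurable M (count_space UNIV)"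
    unfolding piece_def by measurable
  define F where "F \<omega> = c (piece \<omega>)" for \<omega>
  have coeff: "(\<lambda>\<omega>. cinner f (F \<omega>)) \<in> borel_measurable M" for f
    unfolding F_def by measurable
  have int: "(\<integral>\<^sup>+ \<omega>. ennreal ((cmod (cinner f (F \<omega>)))\<^sup>2) \<partial>M) = ennreal ((norm f)\<^sup>2)" for f
  proof -
    let ?g = "\<lambda>\<omega>. ennreal ((cmod (cinner f (F \<omega>)))\<^sup>2)"
    have g [measurable]: "?g \<in> borel_measurable M"
      using coeff[of f] by measurable
    have term_eq: "(\<integral>\<^sup>+ \<omega>\<in>A i. ?g \<omega> \<partial>M) = ennreal ((cmod (cinner f (gram_schmidt d i)))\<^sup>2)" for i
    proof -
      have "(\<integral>\<^sup>+ \<omega>\<in>A i. ?g \<omega> \<partial>M)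
          = (\<integral>\<^sup>+ \<omega>. ennreal ((cmod (cinner f (c i)))\<^sup>2) * indicator (A i) \<omega> \<partial>M)"
        by (intro nn_integral_cong) (auto simp: F_def piece split: split_indicator)
      also have "\<dots> = ennreal ((cmod (cinner f (c i)))\<^sup>2 * m i)"
        by (simp add: nn_integral_cmult_indicator m m_def ennreal_mult)
      also have "(cmod (cinner f (c i)))\<^sup>2 * m i = (cmod (cinner f (gram_schmidt d i)))\<^sup>2"
      proof (cases "i \<in> I")
        case True
        then have "m i > 0"
          using m[of i] by (simp add: I_def m_def zero_less_measure_iff)
        then show ?thesis
          by (simp add: c_def cinner_scaleR_right norm_mult norm_divide power_mult_distrib
              power_divide)
      next
        case False
        \<comment> \<open>A null piece contributes nothing to the integral, and by the choice of \<open>d\<close> nothing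
          to Parseval's sum.\<close>
        then show ?thesis
          using d(2) by (simp add: c_def gram_schmidt_eq_0)
      qed
      finally show ?thesis .
    qed
    have "(\<integral>\<^sup>+ \<omega>. ?g \<omega> \<partial>M) = (\<integral>\<^sup>+ \<omega>\<in>(\<Union>i. A i). ?g \<omega> \<partial>M)"
      by (rule nn_integral_cong) (simp add: A(2))
    also have "\<dots> = (\<Sum>i. \<integral>\<^sup>+ \<omega>\<in>A i. ?g \<omega> \<partial>M)"
      by (rule nn_integral_disjoint_family[OF g Am A(4)])
    also have "\<dots> = ennreal ((norm f)\<^sup>2)"
      unfolding term_eq using gram_schmidt_parseval[OF d(1), of f]
      by (intro suminf_ennreal_eq) auto
    finally show ?thesis .
  qed
  have "continuous_frame M F"
    unfolding continuous_frame_def weakly_measurable_def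
    by (intro conjI exI[of _ 1] allI coeff) (simp_all add: int)
  then show ?thesis
    by blast
qed

end
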